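(* Let $k\ge 1$ be an integer and let $S_{2k}=K_{1,2k-1}$ be the star graph on $2k$ vertices. Then the $k$-token graph $F_k(S_{2k})$ is isomorphic to the double odd graph $2O_k$.
   Context: All graphs are finite and simple. For a graph $G$ on $n$ vertices and $1\le k\le n$, the $k$-token graph $F_k(G)$ has as vertices the $k$-subsets of $V(G)$; two vertices $A,B$ are adjacent iff $A\bigtriangleup B=\{a,b\}$ with $a\in A$, $b\in B$ and $\{a,b\}$ an edge of $G$. The double odd graph $2O_k$ is the graph whose vertices are the $(k-1)$-subsets and the $k$-subsets of $[2k-1]=\{1,\dots,2k-1\}$, where distinct vertices $\gamma,\delta$ are adjacent iff $\gamma\subset\delta$ or $\delta\subset\gamma$. *)

theory Defs
  imports "Graph_Theory.Graph_Theory"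
begin

text \<open>
  A simple graph is a loop-free symmetric digraph without parallel arcs
  (locales \<open>graph\<close> and \<open>pair_graph\<close>): an undirected edge \<open>{u, v}\<close> is the pair of arcs
  \<open>(u, v)\<close>, \<open>(v, u)\<close>. Hence \<^const>\<open>digraph_iso\<close> between two such graphs is graph isomorphism.
\<close>

definition token_graph :: "nat \<Rightarrow> ('a, 'b) pre_digraph \<Rightarrow> 'a set pair_pre_digraph" where
  "token_graph k G = (let V = {A. A \<subseteq> verts G \<and> card A = k} in
    \<lparr> pverts = V,
      parcs = {(A, B). A \<in> V \<and> B \<in> V \<and>
        (\<exists>a\<in>A. \<exists>b\<in>B. sym_diff A B = {a, b} \<and> (a, b) \<in> arcs_ends G)} \<rparr>)"

text \<open>The subtractions are on naturals; the definition is meant for \<open>k \<ge> 1\<close>.\<close>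

definition double_odd_graph :: "nat \<Rightarrow> nat set pair_pre_digraph" where
  "double_odd_graph k = (let V = {\<gamma>. \<gamma> \<subseteq> {1..2 * k - 1} \<and> (card \<gamma> = k - 1 \<or> card \<gamma> = k)} in
    \<lparr> pverts = V,
      parcs = {(\<gamma>, \<delta>). \<gamma> \<in> V \<and> \<delta> \<in> V \<and> (\<gamma> \<subset> \<delta> \<or> \<delta> \<subset> \<gamma>)} \<rparr>)"

lemma pair_graph_token_graph:
  assumes "graph G"
  shows "pair_graph (token_graph k G)"
proof -
  interpret graph G by fact
  have V: "finite (pverts (token_graph k G))"
    by (auto simp: token_graph_def Let_def)
  have sub: "parcs (token_graph k G) \<subseteq> pverts (token_graph k G) \<times> pverts (token_graph k G)"
    by (auto simp: token_graph_def Let_def)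
  have fin: "finite (parcs (token_graph k G))"
    using finite_subset[OF sub] V by blast
  have E: "(b, a) \<in> arcs_ends G" if "(a, b) \<in> arcs_ends G" for a b
    using that sym_arcs by (auto simp: symmetric_def dest: symD)
  have s: "sym (parcs (token_graph k G))"
  proof (rule symI)
    fix A B assume "(A, B) \<in> parcs (token_graph k G)"
    then obtain a b where h: "A \<in> pverts (token_graph k G)" "B \<in> pverts (token_graph k G)"
      "a \<in> A" "b \<in> B" "sym_diff A B = {a, b}" "(a, b) \<in> arcs_ends G"
      by (auto simp: token_graph_def Let_def)
    moreover have "sym_diff B A = {b, a}"
      using h(5) by (simp add: Un_commute insert_commute)
    ultimately show "(B, A) \<in> parcs (token_graph k G)"
      using E[OF h(6)] unfolding token_graph_def Let_def by auto
  qed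
  show ?thesis
    by unfold_locales (use V fin sub s in
      \<open>auto simp: symmetric_def\<close>, auto simp: token_graph_def Let_def)
qed

lemma pair_graph_double_odd_graph: "pair_graph (double_odd_graph k)"
proof -
  have V: "finite (pverts (double_odd_graph k))"
    by (rule finite_subset[of _ "Pow {1..2 * k - 1}"]) (auto simp: double_odd_graph_def Let_def)
  have sub: "parcs (double_odd_graph k) \<subseteq> pverts (double_odd_graph k) \<times> pverts (double_odd_graph k)"
    by (auto simp: double_odd_graph_def Let_def)
  have fin: "finite (parcs (double_odd_graph k))"
    using finite_subset[OF sub] V by blast
  have s: "sym (parcs (double_odd_graph k))"
    by (rule symI) (auto simp: double_odd_graph_def Let_def)
  show ?thesis
    by unfold_locales (use V fin sub s in
      \<open>auto simp: symmetric_def\<close>, auto simp: double_odd_graph_def Let_def)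
qed

lemma ex_star: "\<exists>S :: nat pair_pre_digraph. complete_bipartite_digraph 1 n (with_proj S)"
proof
  let ?S = "\<lparr> pverts = {0} \<union> {1..n}, parcs = {0} \<times> {1..n} \<union> {1..n} \<times> {0} \<rparr>"
  show "complete_bipartite_digraph 1 n (with_proj ?S)"
    unfolding complete_bipartite_digraph_pair_def
    by (intro conjI exI[of _ "{0}"] exI[of _ "{1..n}"]) auto
qed

end

theory Submission
  imports Defs
begin

text \<open>
  Delete the centre of the star from every \<open>k\<close>-subset. A \<open>k\<close>-subset avoiding the centre stays a
  \<open>k\<close>-subset of the \<open>2k - 1\<close> leaves, one containing it becomes a \<open>(k - 1)\<close>-subset, and the
  cardinality tells which case occurred. Moving a token along an edge of the star trades the centre
  for a leaf or conversely, which after deletion means adding or removing a single leaf.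
\<close>

text \<open>An arc of a pair digraph is the pair of its ends, so a vertex bijection dictates the arc
  map \<open>map_prod f f\<close>. Since arcs are preserved and reflected, this map is onto
  \<open>parcs H\<close>, and the image of \<open>G\<close> is all of \<open>H\<close>.\<close>

lemma digraph_iso_with_projI:
  assumes "pair_wf_digraph G" "pair_wf_digraph H"
    and bij: "bij_betw f (pverts G) (pverts H)"
    and arcs: "\<And>u v. u \<in> pverts G \<Longrightarrow> v \<in> pverts G \<Longrightarrow>
      (u, v) \<in> parcs G \<longleftrightarrow> (f u, f v) \<in> parcs H"
  shows "digraph_iso (with_proj G) (with_proj H)"
proof -
  interpret G: pair_wf_digraph G by fact
  interpret H: pair_wf_digraph H by fact
  let ?h = "\<lparr>iso_verts = f, iso_arcs = map_prod f f, iso_head = snd, iso_tail = fst\<rparr>"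
  have inj: "inj_on f (pverts G)" and surj: "f ` pverts G = pverts H"
    using bij by (auto simp: bij_betw_def)
  have sub: "parcs G \<subseteq> pverts G \<times> pverts G"
    by (auto intro: G.in_arcsD1 G.in_arcsD2)
  have "inj_on (map_prod f f) (parcs G)"
    using map_prod_inj_on[OF inj inj] sub by (rule inj_on_subset)
  then have iso: "pre_digraph.digraph_isomorphism (with_proj G) ?h"
    unfolding pre_digraph.digraph_isomorphism_def
    using inj G.wf_digraph_axioms by auto
  have "parcs H = map_prod f f ` parcs G"
  proof (intro equalityI subsetI)
    fix e assume e: "e \<in> parcs H"
    then obtain x y where xy: "e = (x, y)" "x \<in> pverts H" "y \<in> pverts H"
      by (cases e) (auto dest: H.in_arcsD1 H.in_arcsD2)
    then obtain u v where "x = f u" "y = f v" "u \<in> pverts G" "v \<in> pverts G"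
      using surj by blast
    with e xy arcs[of u v] show "e \<in> map_prod f f ` parcs G"
      by force
  next
    fix e assume "e \<in> map_prod f f ` parcs G"
    with sub arcs show "e \<in> parcs H" by auto
  qed
  then have "with_proj H = app_iso ?h (with_proj G)"
    by (simp add: app_iso_def with_proj_def surj)
  with iso show ?thesis unfolding digraph_iso_def by blast
qed

lemma card_remove_eq:
  assumes "card A = k" "1 \<le> k"
  shows "card (A - {c}) = (if c \<in> A then k - 1 else k)"
  using assms by simp

text \<open>The inverse puts \<open>c\<close> back exactly into the sets of size
  \<open>k - 1\<close>. By \<open>1 \<le> k\<close> the sizes \<open>k - 1\<close> and
  \<open>k\<close> differ, so the size of the image reveals whether \<open>c\<close> was
  removed.\<close>

lemma bij_betw_remove:
  fixes k :: nat
  assumes "1 \<le> k" "finite V" "c \<notin> V"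
  shows "bij_betw (\<lambda>A. A - {c}) {A. A \<subseteq> insert c V \<and> card A = k}
    {A. A \<subseteq> V \<and> (card A = k - 1 \<or> card A = k)}"
proof (rule bij_betw_byWitness[where f' = "\<lambda>A. if card A = k then A else insert c A"])
  show "\<forall>A\<in>{A. A \<subseteq> insert c V \<and> card A = k}.
      (if card (A - {c}) = k then A - {c} else insert c (A - {c})) = A"
    using \<open>1 \<le> k\<close> by (auto simp: card_remove_eq split: if_splits)
  show "(\<lambda>A. if card A = k then A else insert c A) `
      {A. A \<subseteq> V \<and> (card A = k - 1 \<or> card A = k)} \<subseteq> {A. A \<subseteq> insert c V \<and> card A = k}"
  proof clarify
    fix A assume A: "A \<subseteq> V" "card A = k - 1 \<or> card A = k"
    have "finite A" "c \<notin> A"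
      using A assms finite_subset by auto
    with A \<open>1 \<le> k\<close> show "(if card A = k then A else insert c A) \<subseteq> insert c V \<and>
        card (if card A = k then A else insert c A) = k"
      by auto
  qed
qed (use assms in \<open>auto simp: card_remove_eq split: if_splits\<close>)

text \<open>Injectivity on \<open>V\<close> preserves cardinalities. The predicate \<open>P\<close>
  is left open so that a single instance covers both layers, \<open>k - 1\<close> and
  \<open>k\<close>.\<close>

lemma bij_betw_image_card:
  assumes "bij_betw g V W"
  shows "bij_betw ((`) g) {A. A \<subseteq> V \<and> P (card A)} {B. B \<subseteq> W \<and> P (card B)}"
proof -
  have "card (g ` A) = card A" if "A \<subseteq> V" for A
    using assms that by (meson bij_betw_def card_image inj_on_subset)
  moreover have "bij_betw ((`) g) (Pow V) (Pow W)"
    using assms by (rule bij_betw_Pow)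
  ultimately have "bij_betw ((`) g) {A \<in> Pow V. P (card A)} {B \<in> Pow W. P (card B)}"
    by (intro bij_betw_Collect) auto
  then show ?thesis by simp
qed

text \<open>Without \<open>c\<close> both sets have size \<open>k - 1\<close> or \<open>k\<close>. A
  strict inclusion therefore means that only the smaller one has lost \<open>c\<close> and that the
  larger one has exactly one leaf more; \<open>c\<close> and this leaf are the ends of the edge
  used.\<close>

lemma star_token_move_iff:
  assumes "1 \<le> k" "finite V" "c \<notin> V"
    and A: "A \<subseteq> insert c V" "card A = k" and B: "B \<subseteq> insert c V" "card B = k"
  shows "(\<exists>a\<in>A. \<exists>b\<in>B. sym_diff A B = {a, b} \<and> (a, b) \<in> {c} \<times> V \<union> V \<times> {c}) \<longleftrightarrow>
    A - {c} \<subset> B - {c} \<or> B - {c} \<subset> A - {c}" (is "?move A B \<longleftrightarrow> ?sub A B \<or> ?sub B A")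
proof -
  \<comment> \<open>A move can be reversed, so the passage from an inclusion to a move has to be
    shown for one orientation only.\<close>
  have swap: "?move A B \<longleftrightarrow> ?move B A" for A B
    by (auto simp: Un_commute insert_commute)
  have sub: "?move A B"
    if A: "A \<subseteq> insert c V" "card A = k" and B: "B \<subseteq> insert c V" "card B = k"
      and psub: "?sub A B" for A B
  proof -
    have fin: "finite A" "finite B"
      using A B \<open>finite V\<close> finite_subset by blast+
    \<comment> \<open>With only \<open>k - 1\<close> and \<open>k\<close> available, the strict
      increase fixes both sizes: \<open>A\<close> contains the centre and \<open>B\<close> does
      not.\<close>
    then have less: "card (A - {c}) < card (B - {c})"
      using psub by (simp add: psubset_card_mono)
    with A B \<open>1 \<le> k\<close> have c: "c \<in> A" "c \<notin> B"
      by (auto simp: card_remove_eq split: if_splits)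
    \<comment> \<open>This is \<open>k - (k - 1)\<close>, equal to 1 because
      \<open>1 \<le> k\<close>; the single element is the leaf that receives the token from
      \<open>c\<close>.\<close>
    have "card (B - (A - {c})) = card B - card (A - {c})"
      using psub fin c by (intro card_Diff_subset) auto
    also have "\<dots> = 1"
      using A B c \<open>1 \<le> k\<close> by (simp add: card_remove_eq)
    finally obtain b where b: "B - (A - {c}) = {b}"
      by (rule card_1_singletonE)
    then have "b \<in> B" "b \<in> V" "sym_diff A B = {c, b}"
      using psub c B by auto
    then show ?thesis using c by blast
  qed
  have "?move A B" if "?sub B A"
    using sub[OF B A that] by (rule swap[THEN iffD2])
  moreover have "?sub A B \<or> ?sub B A" if move: "?move A B"
  proof -
    obtain a b where ab: "a \<in> A" "b \<in> B" "sym_diff A B = {a, b}"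
      and c: "a = c \<and> b \<in> V \<or> a \<in> V \<and> b = c"
      using move by auto
    \<comment> \<open>Read pointwise, \<open>A\<close> and \<open>B\<close> disagree only at
      \<open>a\<close> and \<open>b\<close>. One of these is \<open>c\<close>, so after its removal
      they differ in one leaf.\<close>
    have mem: "(x \<in> A) \<noteq> (x \<in> B) \<longleftrightarrow> x = a \<or> x = b" for x
      using arg_cong[OF ab(3), of "\<lambda>X. x \<in> X"] by simp blast
    have "a \<notin> B" "b \<notin> A"
      using mem[of a] mem[of b] ab(1,2) by simp_all
    from c show ?thesis
    proof (elim disjE conjE)
      assume "a = c" "b \<in> V"
      then have "A - {c} \<subseteq> B - {c}" "b \<in> B - {c}" "b \<notin> A - {c}"
        using mem \<open>b \<notin> A\<close> ab(2) \<open>c \<notin> V\<close> by auto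
      then show ?thesis by blast
    next
      assume "a \<in> V" "b = c"
      then have "B - {c} \<subseteq> A - {c}" "a \<in> A - {c}" "a \<notin> B - {c}"
        using mem \<open>a \<notin> B\<close> ab(1) \<open>c \<notin> V\<close> by auto
      then show ?thesis by blast
    qed
  qed
  ultimately show ?thesis
    using sub[OF A B] by iprover
qed

theorem mainTheorem6:
  fixes k :: nat and S :: "('a, 'b) pre_digraph"
  assumes "k \<ge> 1"
    and "complete_bipartite_digraph 1 (2 * k - 1) S"
  shows "digraph_iso (with_proj (token_graph k S)) (with_proj (double_odd_graph k))"
proof -
  interpret S: graph S
    using assms(2) by (simp add: complete_bipartite_digraph_def)
  obtain U V where UV: "verts S = U \<union> V" "U \<inter> V = {}" "card U = 1" "card V = 2 * k - 1"
    "arcs_ends S = U \<times> V \<union> V \<times> U"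
    using assms(2) by (auto simp: complete_bipartite_digraph_def)
  obtain c where c: "U = {c}"
    using UV(3) by (rule card_1_singletonE)
  have V: "verts S = insert c V" "c \<notin> V" "finite V" "arcs_ends S = {c} \<times> V \<union> V \<times> {c}"
    using UV c S.finite_verts by auto
  obtain g where g: "bij_betw g V {1..2 * k - 1}"
    using finite_same_card_bij[of V "{1..2 * k - 1}"] V(3) UV(4) by auto
  then have inj: "inj_on g V" by (simp add: bij_betw_def)
  \<comment> \<open>Inclusions are also reflected, because \<open>g\<close> is injective on the
    whole of \<open>V\<close>, which contains both sets.\<close>
  have psub: "g ` X \<subset> g ` Y \<longleftrightarrow> X \<subset> Y" if "X \<subseteq> V" "Y \<subseteq> V" for X Y
  proof -
    have "g x \<in> g ` Y \<longleftrightarrow> x \<in> Y" if "x \<in> X" for x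
      using inj \<open>X \<subseteq> V\<close> \<open>Y \<subseteq> V\<close> that by (intro inj_on_image_mem_iff[of g V]) auto
    then have "g ` X \<subseteq> g ` Y \<longleftrightarrow> X \<subseteq> Y"
      by (simp add: image_subset_iff subset_eq)
    then show ?thesis
      using that inj_on_image_eq_iff[OF inj] by (simp only: psubset_eq)
  qed
  \<comment> \<open>The isomorphism deletes the centre and then renames the leaves by
    \<open>g\<close> as the numbers from 1 to \<open>2 * k - 1\<close>.\<close>
  let ?f = "\<lambda>A. g ` (A - {c})"
  have vT: "pverts (token_graph k S) = {A. A \<subseteq> insert c V \<and> card A = k}"
    by (simp add: token_graph_def Let_def V)
  have vD: "pverts (double_odd_graph k) =
      {B. B \<subseteq> {1..2 * k - 1} \<and> (card B = k - 1 \<or> card B = k)}"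
    by (simp add: double_odd_graph_def Let_def)
  have bij: "bij_betw ?f (pverts (token_graph k S)) (pverts (double_odd_graph k))"
    using bij_betw_trans[OF bij_betw_remove[OF assms(1) V(3,2)]
        bij_betw_image_card[OF g, where P = "\<lambda>n. n = k - 1 \<or> n = k"]]
    by (simp add: vT vD comp_def)
  show ?thesis
  proof (rule digraph_iso_with_projI[OF _ _ bij])
    show "pair_wf_digraph (token_graph k S)"
      using pair_graph_token_graph[OF S.graph_axioms]
      by (simp add: pair_graph_def pair_digraph_def pair_fin_digraph_def)
    show "pair_wf_digraph (double_odd_graph k)"
      using pair_graph_double_odd_graph
      by (simp add: pair_graph_def pair_digraph_def pair_fin_digraph_def)
  next
    fix A B assume AB: "A \<in> pverts (token_graph k S)" "B \<in> pverts (token_graph k S)"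
    then have f: "?f A \<in> pverts (double_odd_graph k)" "?f B \<in> pverts (double_odd_graph k)"
      using bij bij_betwE by blast+
    have sub: "A - {c} \<subseteq> V" "B - {c} \<subseteq> V"
      using AB vT by auto
    have "(A, B) \<in> parcs (token_graph k S) \<longleftrightarrow>
        (\<exists>a\<in>A. \<exists>b\<in>B. sym_diff A B = {a, b} \<and> (a, b) \<in> {c} \<times> V \<union> V \<times> {c})"
      using AB vT by (simp add: token_graph_def Let_def V)
    also have "\<dots> \<longleftrightarrow> A - {c} \<subset> B - {c} \<or> B - {c} \<subset> A - {c}"
      using AB vT by (intro star_token_move_iff[OF assms(1) V(3,2)]) auto
    also have "\<dots> \<longleftrightarrow> ?f A \<subset> ?f B \<or> ?f B \<subset> ?f A"
      using psub sub by (simp only:)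
    also have "\<dots> \<longleftrightarrow> (?f A, ?f B) \<in> parcs (double_odd_graph k)"
      using f by (simp add: double_odd_graph_def Let_def)
    finally show "(A, B) \<in> parcs (token_graph k S) \<longleftrightarrow>
        (?f A, ?f B) \<in> parcs (double_odd_graph k)" .
  qed
qed

end
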